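(* Let $(D,\dashv,\vdash,\alpha,\beta)$ be a BiHom-associative dialgebra and let $N:D\to D$ be a Nijenhuis operator on $D$, i.e. $N$ is linear, $\alpha\circ N=N\circ\alpha$, $\beta\circ N=N\circ\beta$, and for all $x,y\in D$ $$N(x)\dashv N(y)=N\big(N(x)\dashv y+x\dashv N(y)-N(x\dashv y)\big),$$ $$N(x)\vdash N(y)=N\big(N(x)\vdash y+x\vdash N(y)-N(x\vdash y)\big).$$ Then $(D,\triangleleft,\triangleright,\alpha,\beta)$ is a BiHom-associative dialgebra, where for all $x,y\in D$ $$x\triangleleft y=N(x)\dashv y+x\dashv N(y)-N(x\dashv y),\qquad x\triangleright y=N(x)\vdash y+x\vdash N(y)-N(x\vdash y).$$
   Context: All vector spaces are over a fixed field. A BiHom-associative dialgebra is a tuple $(A,\dashv,\vdash,\alpha,\beta)$ consisting of a vector space $A$, bilinear maps $\dashv,\vdash:A\times A\to A$ and linear maps $\alpha,\beta:A\to A$ such that $\alpha\circ\beta=\beta\circ\alpha$ and, for all $x,y,z\in A$: (i) $(x\dashv y)\dashv\beta(z)=\alpha(x)\dashv(y\dashv z)$; (ii) $(x\dashv y)\dashv\beta(z)=\alpha(x)\dashv(y\vdash z)$; (iii) $(x\vdash y)\dashv\beta(z)=\alpha(x)\vdash(y\dashv z)$; (iv) $(x\dashv y)\vdash\beta(z)=\alpha(x)\vdash(y\vdash z)$; (v) $(x\vdash y)\vdash\beta(z)=\alpha(x)\vdash(y\vdash z)$. *)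

theory Defs
  imports Complex_Main
begin

definition bilinear_map ::
  "('k::field \<Rightarrow> 'v::ab_group_add \<Rightarrow> 'v) \<Rightarrow> ('v \<Rightarrow> 'v \<Rightarrow> 'v) \<Rightarrow> bool" where
  "bilinear_map scale f \<longleftrightarrow>
     (\<forall>x. Vector_Spaces.linear scale scale (\<lambda>y. f x y)) \<and>
     (\<forall>y. Vector_Spaces.linear scale scale (\<lambda>x. f x y))"

text \<open>The underlying vector space is the whole type \<open>'v\<close> with scalar multiplication \<open>scale\<close>.
  In the locale parameters, \<open>l\<close> is the product written with the left tack and \<open>r\<close> the one
  written with the right tack. No multiplicativity of \<open>\<alpha>\<close> and \<open>\<beta>\<close> is required.\<close>

locale bihom_associative_dialgebra = vector_space scale
  for scale :: "'k::field \<Rightarrow> 'v::ab_group_add \<Rightarrow> 'v" +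
  fixes l :: "'v \<Rightarrow> 'v \<Rightarrow> 'v"  (infixl "\<stileturn>" 70)
    and r :: "'v \<Rightarrow> 'v \<Rightarrow> 'v"  (infixl "\<turnstile>" 70)
    and \<alpha> :: "'v \<Rightarrow> 'v"
    and \<beta> :: "'v \<Rightarrow> 'v"
  assumes bilinear_l: "bilinear_map scale (\<stileturn>)"
    and bilinear_r: "bilinear_map scale (\<turnstile>)"
    and linear_\<alpha>: "Vector_Spaces.linear scale scale \<alpha>"
    and linear_\<beta>: "Vector_Spaces.linear scale scale \<beta>"
    and \<alpha>_\<beta>_commute: "\<alpha> \<circ> \<beta> = \<beta> \<circ> \<alpha>"
    and l_l_eq_l_l: "(x \<stileturn> y) \<stileturn> \<beta> z = \<alpha> x \<stileturn> (y \<stileturn> z)"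
    and l_l_eq_l_r: "(x \<stileturn> y) \<stileturn> \<beta> z = \<alpha> x \<stileturn> (y \<turnstile> z)"
    and r_l_eq_r_l: "(x \<turnstile> y) \<stileturn> \<beta> z = \<alpha> x \<turnstile> (y \<stileturn> z)"
    and l_r_eq_r_r: "(x \<stileturn> y) \<turnstile> \<beta> z = \<alpha> x \<turnstile> (y \<turnstile> z)"
    and r_r_eq_r_r: "(x \<turnstile> y) \<turnstile> \<beta> z = \<alpha> x \<turnstile> (y \<turnstile> z)"

locale nijenhuis_operator = bihom_associative_dialgebra scale l r \<alpha> \<beta>
  for scale :: "'k::field \<Rightarrow> 'v::ab_group_add \<Rightarrow> 'v"
    and l :: "'v \<Rightarrow> 'v \<Rightarrow> 'v"  (infixl "\<stileturn>" 70)
    and r :: "'v \<Rightarrow> 'v \<Rightarrow> 'v"  (infixl "\<turnstile>" 70)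
    and \<alpha> :: "'v \<Rightarrow> 'v"
    and \<beta> :: "'v \<Rightarrow> 'v" +
  fixes N :: "'v \<Rightarrow> 'v"
  assumes linear_N: "Vector_Spaces.linear scale scale N"
    and \<alpha>_N_commute: "\<alpha> \<circ> N = N \<circ> \<alpha>"
    and \<beta>_N_commute: "\<beta> \<circ> N = N \<circ> \<beta>"
    and nijenhuis_l: "N x \<stileturn> N y = N (N x \<stileturn> y + x \<stileturn> N y - N (x \<stileturn> y))"
    and nijenhuis_r: "N x \<turnstile> N y = N (N x \<turnstile> y + x \<turnstile> N y - N (x \<turnstile> y))"

end

theory Submission
  imports Defs
begin

text \<open>Each of the five axioms equates a left-nested product \<open>(x \<cdot>\<^sub>1 y) \<cdot>\<^sub>2 \<beta> z\<close> with a
  right-nested product \<open>\<alpha> x \<cdot>\<^sub>3 (y \<cdot>\<^sub>4 z)\<close>. Each side is a trilinear map \<open>T\<close>, and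
  the axiom says that the two maps coincide. The Nijenhuis
  identity says that \<open>N\<close> maps the deformed product of \<open>x\<close> and \<open>y\<close> to the original product of
  \<open>N x\<close> and \<open>N y\<close>. Together with the fact that \<open>N\<close> commutes with \<open>\<alpha>\<close> and \<open>\<beta>\<close>, this shows that
  the corresponding nested deformed product is the same expression in \<open>N\<close> and \<open>T\<close> in both cases,
  namely \<open>T (N x) (N y) z + T (N x) y (N z) + T x (N y) (N z) - N (T (N x) y z + T x (N y) z +
  T x y (N z)) + N (N (T x y z))\<close> (lemmas \<open>deformed_left_nested\<close> and
  \<open>deformed_right_nested\<close>). Hence every axiom of this shape passes from the original products to
  the deformed ones, whichever of the two products occupy the four places.\<close>

text \<open>The product obtained by deforming \<open>f\<close> along \<open>N\<close>.\<close>

definition deformed_product ::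
  "('v \<Rightarrow> 'v) \<Rightarrow> ('v \<Rightarrow> 'v \<Rightarrow> 'v) \<Rightarrow> 'v \<Rightarrow> 'v \<Rightarrow> 'v::ab_group_add" where
  "deformed_product N f x y = f (N x) y + f x (N y) - N (f x y)"

text \<open>The corresponding deformation of a trilinear map.\<close>

definition deformed_triple_product ::
  "('v \<Rightarrow> 'v) \<Rightarrow> ('v \<Rightarrow> 'v \<Rightarrow> 'v \<Rightarrow> 'v) \<Rightarrow> 'v \<Rightarrow> 'v \<Rightarrow> 'v \<Rightarrow> 'v::ab_group_add" where
  "deformed_triple_product N T x y z =
     T (N x) (N y) z + T (N x) y (N z) + T x (N y) (N z)
     - N (T (N x) y z + T x (N y) z + T x y (N z)) + N (N (T x y z))"

lemma bilinear_map_simps: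
  assumes "bilinear_map scale f"
  shows "f (x + x') y = f x y + f x' y" "f (x - x') y = f x y - f x' y"
    and "f x (y + y') = f x y + f x y'" "f x (y - y') = f x y - f x y'"
    and "f (scale c x) y = scale c (f x y)" "f x (scale c y) = scale c (f x y)"
proof -
  have lin: "Vector_Spaces.linear scale scale (f x)"
    "Vector_Spaces.linear scale scale (\<lambda>x. f x y)" for x y
    using assms by (auto simp: bilinear_map_def)
  interpret A: Vector_Spaces.linear scale scale "\<lambda>x. f x y" by (rule lin(2))
  interpret B: Vector_Spaces.linear scale scale "f x" by (rule lin(1))
  show "f (x + x') y = f x y + f x' y" "f (x - x') y = f x y - f x' y"
    by (rule A.add A.diff)+
  show "f x (y + y') = f x y + f x y'" "f x (y - y') = f x y - f x y'"
    by (rule B.add B.diff)+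
  show "f (scale c x) y = scale c (f x y)" "f x (scale c y) = scale c (f x y)"
    by (rule A.scale B.scale)+
qed

lemma bilinear_map_deformed_product:
  assumes f: "bilinear_map scale f" and N: "Vector_Spaces.linear scale scale N"
  shows "bilinear_map scale (deformed_product N f)"
proof -
  interpret N: Vector_Spaces.linear scale scale N by (rule N)
  show ?thesis
    unfolding bilinear_map_def linear_iff_module_hom
    by (simp add: module_hom_iff N.vs1.module_axioms deformed_product_def N.add N.diff N.scale
          bilinear_map_simps[OF f] N.vs1.scale_right_distrib N.vs1.scale_right_diff_distrib)
qed

lemma deformed_left_nested:
  assumes f: "bilinear_map scale f" and g: "bilinear_map scale g"
    and N: "Vector_Spaces.linear scale scale N" and comm: "\<beta> \<circ> N = N \<circ> \<beta>"
    and nij_f: "\<And>x y. f (N x) (N y) = N (deformed_product N f x y)"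
    and nij_g: "\<And>x y. g (N x) (N y) = N (deformed_product N g x y)"
  shows "deformed_product N g (deformed_product N f x y) (\<beta> z)
       = deformed_triple_product N (\<lambda>x y z. g (f x y) (\<beta> z)) x y z"
proof -
  interpret N: Vector_Spaces.linear scale scale N by (rule N)
  let ?d = "deformed_product N"
  have comm': "N (\<beta> u) = \<beta> (N u)" for u
    using comm by (metis comp_apply)
  have "?d g (?d f x y) (\<beta> z)
      = g (f (N x) (N y)) (\<beta> z) + g (?d f x y) (N (\<beta> z)) - N (g (?d f x y) (\<beta> z))"
    by (simp add: deformed_product_def[of N g] nij_f)
  \<comment> \<open>The last summand \<open>N (f x y)\<close> of the deformed product of \<open>x\<close> and \<open>y\<close> meets \<open>N (\<beta> z)\<close>, so
    the Nijenhuis identity for \<open>g\<close> applies.\<close>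
  also have "g (?d f x y) (N (\<beta> z))
      = g (f (N x) y) (N (\<beta> z)) + g (f x (N y)) (N (\<beta> z)) - N (?d g (f x y) (\<beta> z))"
    by (simp add: deformed_product_def[of N f] bilinear_map_simps[OF g] nij_g)
  finally show ?thesis
    by (simp add: deformed_product_def deformed_triple_product_def comm' N.add N.diff
        bilinear_map_simps[OF g] algebra_simps)
qed

lemma deformed_right_nested:
  assumes f: "bilinear_map scale f" and g: "bilinear_map scale g"
    and N: "Vector_Spaces.linear scale scale N" and comm: "\<alpha> \<circ> N = N \<circ> \<alpha>"
    and nij_f: "\<And>x y. f (N x) (N y) = N (deformed_product N f x y)"
    and nij_g: "\<And>x y. g (N x) (N y) = N (deformed_product N g x y)"
  shows "deformed_product N g (\<alpha> x) (deformed_product N f y z)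
       = deformed_triple_product N (\<lambda>x y z. g (\<alpha> x) (f y z)) x y z"
proof -
  interpret N: Vector_Spaces.linear scale scale N by (rule N)
  let ?d = "deformed_product N"
  have comm': "N (\<alpha> u) = \<alpha> (N u)" for u
    using comm by (metis comp_apply)
  have "?d g (\<alpha> x) (?d f y z)
      = g (N (\<alpha> x)) (?d f y z) + g (\<alpha> x) (f (N y) (N z)) - N (g (\<alpha> x) (?d f y z))"
    by (simp add: deformed_product_def[of N g] nij_f)
  \<comment> \<open>The last summand \<open>N (f y z)\<close> of the deformed product of \<open>y\<close> and \<open>z\<close> meets \<open>N (\<alpha> x)\<close>, so
    the Nijenhuis identity for \<open>g\<close> applies.\<close>
  also have "g (N (\<alpha> x)) (?d f y z)
      = g (N (\<alpha> x)) (f (N y) z) + g (N (\<alpha> x)) (f y (N z)) - N (?d g (\<alpha> x) (f y z))"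
    by (simp add: deformed_product_def[of N f] bilinear_map_simps[OF g] nij_g)
  finally show ?thesis
    by (simp add: deformed_product_def deformed_triple_product_def comm' N.add N.diff
        bilinear_map_simps[OF g] algebra_simps)
qed

theorem proposition2p21:
  fixes scale :: "'k::field \<Rightarrow> 'v::ab_group_add \<Rightarrow> 'v"
    and l r :: "'v \<Rightarrow> 'v \<Rightarrow> 'v"
    and \<alpha> \<beta> N :: "'v \<Rightarrow> 'v"
  assumes "bihom_associative_dialgebra scale l r \<alpha> \<beta>"
    and "nijenhuis_operator scale l r \<alpha> \<beta> N"
  shows "bihom_associative_dialgebra scale
           (\<lambda>x y. l (N x) y + l x (N y) - N (l x y))
           (\<lambda>x y. r (N x) y + r x (N y) - N (r x y)) \<alpha> \<beta>"
proof -
  interpret nijenhuis_operator scale l r \<alpha> \<beta> N by (rule assms(2))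
  have nij_l: "l (N x) (N y) = N (deformed_product N l x y)"
    and nij_r: "r (N x) (N y) = N (deformed_product N r x y)" for x y
    by (simp_all add: deformed_product_def nijenhuis_l nijenhuis_r)
  note left = deformed_left_nested[OF _ _ linear_N \<beta>_N_commute]
  note right = deformed_right_nested[OF _ _ linear_N \<alpha>_N_commute]
  note left_nested =
    left[OF bilinear_l bilinear_l nij_l nij_l] left[OF bilinear_l bilinear_r nij_l nij_r]
    left[OF bilinear_r bilinear_l nij_r nij_l] left[OF bilinear_r bilinear_r nij_r nij_r]
  note right_nested =
    right[OF bilinear_l bilinear_l nij_l nij_l] right[OF bilinear_l bilinear_r nij_l nij_r]
    right[OF bilinear_r bilinear_l nij_r nij_l] right[OF bilinear_r bilinear_r nij_r nij_r]
  have "bihom_associative_dialgebra scale (deformed_product N l) (deformed_product N r) \<alpha> \<beta>"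
  proof (intro bihom_associative_dialgebra.intro bihom_associative_dialgebra_axioms.intro)
    show "bilinear_map scale (deformed_product N l)" "bilinear_map scale (deformed_product N r)"
      by (intro bilinear_map_deformed_product bilinear_l bilinear_r linear_N)+
  qed (simp_all only: vector_space_axioms linear_\<alpha> linear_\<beta> \<alpha>_\<beta>_commute left_nested right_nested
         l_l_eq_l_l l_l_eq_l_r[symmetric] r_l_eq_r_l l_r_eq_r_r r_r_eq_r_r)
  then show ?thesis
    by (simp only: deformed_product_def[abs_def])
qed

end
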